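(* Let $G_{1}=(V_{1},E_{1})$ and $G_{2}=(V_{2},E_{2})$ be finite simple undirected graphs with disjoint non-empty vertex sets, neither of which has an isolated vertex, and let $G_1\square G_2$ be their Cartesian product. Then \begin{align*} N^{(i)}(G_{1} \square G_{2},x)=\;& 1+|V_{1}|\bigl(N^{(i)}(G_{2},x)-1\bigr)+|V_{2}|\bigl(N^{(i)}(G_{1},x)-1\bigr)\\ &+\sum_{(u,v)\in V_{1}\times V_{2}} \bigl(I(G_{1}[N_{G_{1}}(u)],x)-1\bigr)\bigl(I(G_{2}[N_{G_{2}}(v)],x)-1\bigr)\\ &-|V_{1}||V_{2}|x - 2|E_{1}||E_{2}|x^{2}. \end{align*}
   Context: For a finite simple undirected graph $G=(V,E)$ and $v\in V$, the open neighborhood of $v$ in $G$ is $N_G(v)=\{u \mid \{u,v\}\in E\}$, and $G[X]$ denotes the subgraph induced by $X\subseteq V$. The independence polynomial of a graph $G$ of order $n$ is $I(G,x)=\sum_{k=0}^{n} i_k(G)x^k$, where $i_k(G)$ is the number of independent vertex subsets of cardinality $k$ in $G$ (the empty set is independent). The independent neighborhood polynomial of $G$ is $N^{(i)}(G,x)=\sum_{k=0}^{n} n_k^{(i)}(G)x^k$, where $n_k^{(i)}(G)$ is the number of independent vertex subsets $A\subseteq V$ with $|A|=k$ for which there exists $v\in V$ with $A\subseteq N_G(v)$ (the empty set is counted). The Cartesian product $G_1\square G_2$ has vertex set $V_1\times V_2$, and $(x_1,x_2)$, $(y_1,y_2)$ are adjacent if and only if either $x_1=y_1$ and $\{x_2,y_2\}\in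 E_2$, or $x_2=y_2$ and $\{x_1,y_1\}\in E_1$. *)

theory Defs
  imports "HOL-Computational_Algebra.Polynomial"
begin

type_synonym 'a ugraph = "'a set \<times> 'a set set"

abbreviation verts :: "'a ugraph \<Rightarrow> 'a set" where
  "verts G \<equiv> fst G"

abbreviation edges :: "'a ugraph \<Rightarrow> 'a set set" where
  "edges G \<equiv> snd G"

definition simple_graph :: "'a ugraph \<Rightarrow> bool" where
  "simple_graph G \<longleftrightarrow> finite (verts G) \<and> (\<forall>e\<in>edges G. e \<subseteq> verts G \<and> card e = 2)"

definition nbhd :: "'a ugraph \<Rightarrow> 'a \<Rightarrow> 'a set" where
  "nbhd G v = {u. {u, v} \<in> edges G}"

definition isolated :: "'a ugraph \<Rightarrow> 'a \<Rightarrow> bool" where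
  "isolated G v \<longleftrightarrow> v \<in> verts G \<and> nbhd G v = {}"

definition induced :: "'a ugraph \<Rightarrow> 'a set \<Rightarrow> 'a ugraph" where
  "induced G X = (X, {e \<in> edges G. e \<subseteq> X})"

definition indep :: "'a ugraph \<Rightarrow> 'a set \<Rightarrow> bool" where
  "indep G A \<longleftrightarrow> A \<subseteq> verts G \<and> (\<forall>u\<in>A. \<forall>v\<in>A. {u, v} \<notin> edges G)"

text \<open>Integer coefficients are used so that the counting polynomials can be subtracted.\<close>

definition indep_poly :: "'a ugraph \<Rightarrow> int poly" where
  "indep_poly G =
     (\<Sum>k = 0..card (verts G). monom (int (card {A. indep G A \<and> card A = k})) k)"

definition indep_nbhd_poly :: "'a ugraph \<Rightarrow> int poly" where
  "indep_nbhd_poly G =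
     (\<Sum>k = 0..card (verts G).
        monom (int (card {A. indep G A \<and> card A = k \<and> (\<exists>v\<in>verts G. A \<subseteq> nbhd G v)})) k)"

definition cart_prod :: "'a ugraph \<Rightarrow> 'b ugraph \<Rightarrow> ('a \<times> 'b) ugraph" where
  "cart_prod G H =
     (verts G \<times> verts H,
      {{(x1, x2), (y1, y2)} | x1 x2 y1 y2.
         (x1, x2) \<in> verts G \<times> verts H \<and> (y1, y2) \<in> verts G \<times> verts H \<and>
         (x1 = y1 \<and> {x2, y2} \<in> edges H \<or> x2 = y2 \<and> {x1, y1} \<in> edges G)})"

lemma simple_graph_induced:
  "simple_graph G \<Longrightarrow> X \<subseteq> verts G \<Longrightarrow> simple_graph (induced G X)"
  by (auto simp: simple_graph_def induced_def intro: finite_subset)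

lemma simple_graph_cart_prod:
  assumes "simple_graph G" "simple_graph H"
  shows "simple_graph (cart_prod G H)"
  using assms unfolding simple_graph_def cart_prod_def
  by (fastforce simp: card_2_iff doubleton_eq_iff)

end

theory Submission
  imports Defs
begin

text \<open>
Why the formula holds. In the product, the neighbourhood of \<open>(u, v)\<close> is a cross: the vertices
\<open>(u, w)\<close> with \<open>w\<close> a neighbour of \<open>v\<close>, and the vertices \<open>(t, v)\<close> with \<open>t\<close> a neighbour of \<open>u\<close>. No
vertex of one arm is adjacent to a vertex of the other, so an independent set below this
neighbourhood is exactly \<open>{u} \<times> B \<union> C \<times> {v}\<close> with \<open>B\<close> and \<open>C\<close> independent sets of neighbours of
\<open>v\<close> and \<open>u\<close> (lemma \<open>nbhd_indeps_cart_prod\<close>). The non-empty ones are of three kinds.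

\<^item> If \<open>C\<close> is empty, the set is a row \<open>{u} \<times> B\<close>; these give \<open>|V\<^sub>1|\<close> copies of the family of the
  second graph.

\<^item> If \<open>B\<close> is empty, the set is a column; these give \<open>|V\<^sub>2|\<close> copies of the family of the first
  graph. A set is both a row and a column exactly when it is a singleton. Without isolated
  vertices every vertex of the product occurs as such a singleton, hence the correction
  \<open>|V\<^sub>1||V\<^sub>2|x\<close>.

\<^item> If both are non-empty, the set has two first and two second coordinates, so it is neither a row
  nor a column. Summing over all \<open>(u, v, C, B)\<close> gives the sum of products in the formula, but it
  counts descriptions rather than sets. Two descriptions of one set differ only if the set is a
  pair of opposite corners of a square, \<open>{(u, w), (t, v)} = {t} \<times> {v} \<union> {u} \<times> {w}\<close>, read from
  \<open>(u, v)\<close> or from \<open>(t, w)\<close> (lemma \<open>cross_eq_cases\<close>). Corner pairs are thus counted twice. There are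
  \<open>4|E\<^sub>1||E\<^sub>2|\<close> descriptions, one for each pair of directed edges, hence \<open>2|E\<^sub>1||E\<^sub>2|\<close> sets of size two
  to subtract (lemma \<open>size_poly_crosses\<close>).
\<close>

section \<open>Enumerating families of sets by size\<close>

definition size_poly :: "'a set set \<Rightarrow> int poly" where
  "size_poly F = (\<Sum>A\<in>F. monom 1 (card A))"

lemma sum_card_monom_eq_size_poly:
  assumes "finite F" and "\<And>A. A \<in> F \<Longrightarrow> card A \<le> n"
  shows "(\<Sum>k = 0..n. monom (int (card {A \<in> F. card A = k})) k) = size_poly F"
proof -
  have "size_poly F = (\<Sum>k = 0..n. \<Sum>A\<in>{A \<in> F. card A = k}. monom 1 (card A))"
    unfolding size_poly_def using assms by (intro sum.group[symmetric]) auto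
  also have "\<dots> = (\<Sum>k = 0..n. monom (int (card {A \<in> F. card A = k})) k)"
    by (intro sum.cong refl) (simp add: of_nat_monom mult_monom)
  finally show ?thesis by simp
qed

text \<open>The constant term 1 of both graph polynomials is the contribution of the empty set, which is why
the formula is written with differences from 1.\<close>

lemma size_poly_minus_one:
  assumes "finite F" and "{} \<in> F"
  shows "size_poly F - 1 = size_poly (F - {{}})"
  using assms by (simp add: size_poly_def sum.remove one_pCons monom_0)

lemma size_poly_Un:
  assumes "finite F" and "finite F'"
  shows "size_poly (F \<union> F') = size_poly F + size_poly F' - size_poly (F \<inter> F')"
  using sum.union_inter[OF assms, of "\<lambda>A. monom 1 (card A) :: int poly"]
  by (simp add: size_poly_def algebra_simps)

lemma size_poly_const_card:
  assumes "\<And>A. A \<in> F \<Longrightarrow> card A = k"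
  shows "size_poly F = of_nat (card F) * monom 1 k"
  using assms by (simp add: size_poly_def)

lemma size_poly_image:
  assumes "inj_on f S"
  shows "size_poly (f ` S) = (\<Sum>x\<in>S. monom 1 (card (f x)))"
  by (simp add: size_poly_def sum.reindex[OF assms])

text \<open>The fibres of \<open>f\<close> are the orbits of the fixed-point-free map \<open>\<sigma>\<close>. This is used for reversing an edge
and for passing to the opposite corner of a square.\<close>

lemma card_two_to_one:
  assumes fin: "finite S"
    and \<sigma>: "\<And>x. x \<in> S \<Longrightarrow> \<sigma> x \<in> S" "\<And>x. x \<in> S \<Longrightarrow> \<sigma> x \<noteq> x"
    and fib: "\<And>x y. x \<in> S \<Longrightarrow> y \<in> S \<Longrightarrow> f y = f x \<longleftrightarrow> y = x \<or> y = \<sigma> x"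
  shows "card S = 2 * card (f ` S)"
proof -
  have "card {y \<in> S. f y = b} = 2" if b: "b \<in> f ` S" for b
  proof -
    from b obtain x where x: "x \<in> S" "b = f x" by blast
    then have "{y \<in> S. f y = b} = {x, \<sigma> x}" using \<sigma> fib by auto
    then show ?thesis using \<sigma>(2)[OF x(1)] by simp
  qed
  then have "(\<Sum>b\<in>f ` S. card {y \<in> S. f y = b}) = 2 * card (f ` S)" by simp
  moreover have "(\<Sum>b\<in>f ` S. card {y \<in> S. f y = b}) = card S"
    using sum.group[of S "f ` S" f "\<lambda>_. 1::nat"] fin by simp
  ultimately show ?thesis by simp
qed

section \<open>Independent sets inside a neighbourhood\<close>

definition nbhd_indeps :: "'a ugraph \<Rightarrow> 'a \<Rightarrow> 'a set set" where
  "nbhd_indeps G v = {A. indep G A \<and> A \<noteq> {} \<and> A \<subseteq> nbhd G v}"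

lemma edge_in_verts:
  assumes "simple_graph G" and "{u, v} \<in> edges G"
  shows "u \<in> verts G" and "v \<in> verts G" and "u \<noteq> v"
  using assms by (auto simp: simple_graph_def)

lemma no_loops: "simple_graph G \<Longrightarrow> {v} \<notin> edges G"
  by (auto simp: simple_graph_def)

lemma nbhd_subset_verts: "simple_graph G \<Longrightarrow> nbhd G v \<subseteq> verts G"
  by (auto simp: nbhd_def dest: edge_in_verts)

lemma not_in_own_nbhd: "simple_graph G \<Longrightarrow> v \<notin> nbhd G v"
  by (simp add: nbhd_def no_loops)

lemma finite_indep: "simple_graph G \<Longrightarrow> finite {A. indep G A}"
  by (rule finite_subset[of _ "Pow (verts G)"]) (auto simp: indep_def simple_graph_def)

lemma indep_finite: "simple_graph G \<Longrightarrow> indep G A \<Longrightarrow> finite A"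
  by (auto simp: indep_def simple_graph_def intro: finite_subset)

lemma card_indep_le: "simple_graph G \<Longrightarrow> indep G A \<Longrightarrow> card A \<le> card (verts G)"
  by (auto simp: indep_def simple_graph_def intro: card_mono)

lemma finite_nbhd_indeps: "simple_graph G \<Longrightarrow> finite (nbhd_indeps G v)"
  by (rule finite_subset[OF _ finite_indep]) (auto simp: nbhd_indeps_def)

lemma nbhd_indepsD:
  assumes "simple_graph G" and "A \<in> nbhd_indeps G v"
  shows "finite A" "A \<noteq> {}" "v \<notin> A"
  using assms indep_finite not_in_own_nbhd by (fastforce simp: nbhd_indeps_def)+

lemma singleton_in_nbhd_indeps_iff:
  assumes "simple_graph G"
  shows "{t} \<in> nbhd_indeps G v \<longleftrightarrow> {t, v} \<in> edges G"
  using edge_in_verts[OF assms] no_loops[OF assms]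
  by (auto simp: nbhd_indeps_def indep_def nbhd_def)

lemma indep_induced_iff:
  assumes "X \<subseteq> verts G"
  shows "indep (induced G X) A \<longleftrightarrow> indep G A \<and> A \<subseteq> X"
proof (cases "A \<subseteq> X")
  case True
  then have "{u, v} \<subseteq> X" if "u \<in> A" "v \<in> A" for u v using that by blast
  then show ?thesis using True assms by (simp add: indep_def induced_def subset_trans[of A X])
qed (simp add: indep_def induced_def)

lemma indep_poly_nbhd_minus_one:
  assumes G: "simple_graph G"
  shows "indep_poly (induced G (nbhd G v)) - 1 = size_poly (nbhd_indeps G v)"
proof -
  let ?H = "induced G (nbhd G v)"
  have H: "simple_graph ?H"
    using G nbhd_subset_verts by (intro simple_graph_induced)
  have "indep_poly ?H = size_poly {A. indep ?H A}"
    using sum_card_monom_eq_size_poly[OF finite_indep[OF H], of "card (verts ?H)"]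
      card_indep_le[OF H]
    by (simp add: indep_poly_def)
  moreover have "{A. indep ?H A} - {{}} = nbhd_indeps G v"
    using indep_induced_iff[OF nbhd_subset_verts[OF G]] by (auto simp: nbhd_indeps_def)
  ultimately show ?thesis
    using size_poly_minus_one[OF finite_indep[OF H]] by (simp add: indep_def)
qed

text \<open>A set below several neighbourhoods counts once, hence a union of families instead of a sum.\<close>

lemma indep_nbhd_poly_minus_one:
  assumes G: "simple_graph G" and ne: "verts G \<noteq> {}"
  shows "indep_nbhd_poly G - 1 = size_poly (\<Union>v\<in>verts G. nbhd_indeps G v)"
proof -
  let ?F = "{A. indep G A \<and> (\<exists>v\<in>verts G. A \<subseteq> nbhd G v)}"
  have fin: "finite ?F" by (rule finite_subset[OF _ finite_indep[OF G]]) auto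
  have "{A. indep G A \<and> card A = k \<and> (\<exists>v\<in>verts G. A \<subseteq> nbhd G v)} = {A \<in> ?F. card A = k}" for k
    by auto
  then have "indep_nbhd_poly G = size_poly ?F"
    using sum_card_monom_eq_size_poly[OF fin, of "card (verts G)"] card_indep_le[OF G]
    unfolding indep_nbhd_poly_def by simp
  moreover have "?F - {{}} = (\<Union>v\<in>verts G. nbhd_indeps G v)"
    by (auto simp: nbhd_indeps_def)
  moreover have "{} \<in> ?F" using ne by (auto simp: indep_def)
  ultimately show ?thesis using size_poly_minus_one[OF fin] by simp
qed

definition darts :: "'a ugraph \<Rightarrow> ('a \<times> 'a) set" where
  "darts G = {(u, v). {u, v} \<in> edges G}"

lemma finite_darts: "simple_graph G \<Longrightarrow> finite (darts G)"
  by (rule finite_subset[of _ "verts G \<times> verts G"])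
    (auto simp: darts_def simple_graph_def)

lemma card_darts:
  assumes G: "simple_graph G"
  shows "card (darts G) = 2 * card (edges G)"
proof -
  have "card (darts G) = 2 * card ((\<lambda>(u, v). {u, v}) ` darts G)"
    by (rule card_two_to_one[where \<sigma> = prod.swap, OF finite_darts[OF G]])
      (use edge_in_verts(3)[OF G] in \<open>auto simp: darts_def doubleton_eq_iff insert_commute\<close>)
  moreover have "(\<lambda>(u, v). {u, v}) ` darts G = edges G"
  proof
    show "edges G \<subseteq> (\<lambda>(u, v). {u, v}) ` darts G"
    proof
      fix e assume e: "e \<in> edges G"
      then have "card e = 2" using G by (simp add: simple_graph_def)
      then obtain u v where "e = {u, v}" by (auto simp: card_2_iff)
      then show "e \<in> (\<lambda>(u, v). {u, v}) ` darts G"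
        using e by (force simp: darts_def)
    qed
  qed (auto simp: darts_def)
  ultimately show ?thesis by simp
qed

section \<open>Crosses in the Cartesian product\<close>

definition cross :: "'a \<Rightarrow> 'b \<Rightarrow> 'a set \<Rightarrow> 'b set \<Rightarrow> ('a \<times> 'b) set" where
  "cross u v C B = {u} \<times> B \<union> C \<times> {v}"

text \<open>The definition of the product describes an edge through some ordering of its two ends. The
condition is symmetric in the ends, so it may be read off from any ordering.\<close>

lemma edges_cart_prod_iff:
  assumes "simple_graph G" and "simple_graph H"
  shows "{(x1, x2), (y1, y2)} \<in> edges (cart_prod G H) \<longleftrightarrow>
    x1 = y1 \<and> x1 \<in> verts G \<and> {x2, y2} \<in> edges H \<or>
    x2 = y2 \<and> x2 \<in> verts H \<and> {x1, y1} \<in> edges G"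
    (is "_ \<longleftrightarrow> ?R x1 x2 y1 y2")
proof
  have sym: "?R a b c d \<Longrightarrow> ?R c d a b" for a b c d
    by (auto simp: insert_commute)
  assume "{(x1, x2), (y1, y2)} \<in> edges (cart_prod G H)"
  then obtain a b c d where eq: "{(x1, x2), (y1, y2)} = {(a, b), (c, d)}" and R: "?R a b c d"
    by (auto simp: cart_prod_def)
  from eq have "a = x1 \<and> b = x2 \<and> c = y1 \<and> d = y2 \<or> a = y1 \<and> b = y2 \<and> c = x1 \<and> d = x2"
    by (auto simp: doubleton_eq_iff)
  then show "?R x1 x2 y1 y2" using R sym by blast
next
  assume R: "?R x1 x2 y1 y2"
  then have "(x1, x2) \<in> verts G \<times> verts H" "(y1, y2) \<in> verts G \<times> verts H"
    using edge_in_verts[OF assms(1)] edge_in_verts[OF assms(2)] by auto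
  then show "{(x1, x2), (y1, y2)} \<in> edges (cart_prod G H)"
    using R unfolding cart_prod_def snd_conv by blast
qed

lemma verts_cart_prod: "verts (cart_prod G H) = verts G \<times> verts H"
  by (simp add: cart_prod_def)

lemma nbhd_cart_prod:
  assumes "simple_graph G" and "simple_graph H" and "u \<in> verts G" and "v \<in> verts H"
  shows "nbhd (cart_prod G H) (u, v) = cross u v (nbhd G u) (nbhd H v)"
  using assms by (auto simp: nbhd_def cross_def edges_cart_prod_iff)

text \<open>Vertices on different arms differ in both coordinates, since \<open>u \<notin> C\<close> and \<open>v \<notin> B\<close>; so every edge inside
the cross lies within one arm.\<close>

lemma indep_cross:
  assumes G: "simple_graph G" and H: "simple_graph H" and u: "u \<in> verts G" and v: "v \<in> verts H"
    and C: "C \<subseteq> nbhd G u" and B: "B \<subseteq> nbhd H v"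
  shows "indep (cart_prod G H) (cross u v C B) \<longleftrightarrow> indep G C \<and> indep H B"
proof -
  have "u \<notin> C" "v \<notin> B" "C \<subseteq> verts G" "B \<subseteq> verts H"
    using C B not_in_own_nbhd[OF G] not_in_own_nbhd[OF H]
      nbhd_subset_verts[OF G] nbhd_subset_verts[OF H] by blast+
  then show ?thesis
    using u v no_loops[OF G] no_loops[OF H]
    by (auto simp: indep_def verts_cart_prod cross_def edges_cart_prod_iff[OF G H] ball_Un)
qed

lemma subset_cross:
  assumes "A \<subseteq> cross u v X Y"
  obtains C B where "C \<subseteq> X" "B \<subseteq> Y" "A = cross u v C B"
proof
  show "{c \<in> X. (c, v) \<in> A} \<subseteq> X" "{b \<in> Y. (u, b) \<in> A} \<subseteq> Y" by auto
  show "A = cross u v {c \<in> X. (c, v) \<in> A} {b \<in> Y. (u, b) \<in> A}"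
    using assms by (auto simp: cross_def)
qed

lemma nbhd_indeps_cart_prod:
  assumes G: "simple_graph G" and H: "simple_graph H" and u: "u \<in> verts G" and v: "v \<in> verts H"
  shows "nbhd_indeps (cart_prod G H) (u, v) =
    (\<lambda>B. {u} \<times> B) ` nbhd_indeps H v \<union> (\<lambda>C. C \<times> {v}) ` nbhd_indeps G u \<union>
    (\<lambda>(C, B). cross u v C B) ` (nbhd_indeps G u \<times> nbhd_indeps H v)" (is "?L = ?R")
proof -
  have mem: "cross u v C B \<in> ?L \<longleftrightarrow> (indep G C \<and> indep H B) \<and> (C \<noteq> {} \<or> B \<noteq> {})"
    if "C \<subseteq> nbhd G u" "B \<subseteq> nbhd H v" for C B
    using that indep_cross[OF assms that] nbhd_cart_prod[OF assms]
    by (auto simp: nbhd_indeps_def cross_def)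
  have row: "cross u v {} B = {u} \<times> B" and col: "cross u v C {} = C \<times> {v}" for B C
    by (auto simp: cross_def)
  show ?thesis
  proof (intro equalityI subsetI)
    fix A assume A: "A \<in> ?L"
    then have "A \<subseteq> cross u v (nbhd G u) (nbhd H v)"
      using nbhd_cart_prod[OF assms] by (simp add: nbhd_indeps_def)
    then obtain C B where CB: "C \<subseteq> nbhd G u" "B \<subseteq> nbhd H v" "A = cross u v C B"
      by (rule subset_cross)
    with A mem have *: "indep G C" "indep H B" "C \<noteq> {} \<or> B \<noteq> {}" by simp_all
    consider "C = {}" "B \<in> nbhd_indeps H v" | "B = {}" "C \<in> nbhd_indeps G u"
      | "C \<in> nbhd_indeps G u" "B \<in> nbhd_indeps H v"
      using * CB by (auto simp: nbhd_indeps_def)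
    then show "A \<in> ?R"
    proof cases
      case 1
      then show ?thesis using CB(3) row by blast
    next
      case 2
      then show ?thesis using CB(3) col by blast
    next
      case 3
      then show ?thesis using CB(3) by blast
    qed
  next
    fix A assume "A \<in> ?R"
    then show "A \<in> ?L"
    proof (elim UnE imageE)
      fix B assume A: "A = {u} \<times> B" "B \<in> nbhd_indeps H v"
      then have "indep H B" "B \<noteq> {}" "B \<subseteq> nbhd H v" by (simp_all add: nbhd_indeps_def)
      then show ?thesis using mem[of "{}" B] A(1) row by (simp add: indep_def)
    next
      fix C assume A: "A = C \<times> {v}" "C \<in> nbhd_indeps G u"
      then have "indep G C" "C \<noteq> {}" "C \<subseteq> nbhd G u" by (simp_all add: nbhd_indeps_def)
      then show ?thesis using mem[of C "{}"] A(1) col by (simp add: indep_def)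
    next
      fix p assume A: "A = (case p of (C, B) \<Rightarrow> cross u v C B)"
        "p \<in> nbhd_indeps G u \<times> nbhd_indeps H v"
      obtain C B where p: "p = (C, B)" by (rule prod.exhaust)
      then have "indep H B" "B \<noteq> {}" "B \<subseteq> nbhd H v" "indep G C" "C \<subseteq> nbhd G u"
        using A(2) by (simp_all add: nbhd_indeps_def)
      then show ?thesis using mem[of C B] A(1) p by simp
    qed
  qed
qed

lemma card_cross:
  assumes "finite C" and "finite B" and "u \<notin> C"
  shows "card (cross u v C B) = card C + card B"
proof -
  have "card (cross u v C B) = card ({u} \<times> B) + card (C \<times> {v})"
    unfolding cross_def using assms by (intro card_Un_disjoint) auto
  then show ?thesis by (simp add: card_cartesian_product)
qed

lemma cross_eq_same_centre:
  assumes "cross u v C B = cross u v C' B'" and "u \<notin> C" "u \<notin> C'"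
  shows "C = C' \<and> B = B'"
  using assms by (auto simp: cross_def set_eq_iff)

text \<open>If the centres have the same first coordinate \<open>u\<close>, the points off the line over \<open>u\<close> recover \<open>v\<close> and
then both arms. Otherwise the points over \<open>u\<close> form the arm \<open>B\<close> of the first cross, but in the second
cross only \<open>(u, v')\<close> can lie over \<open>u\<close>; so \<open>B\<close> is a singleton, and likewise the other three arms.\<close>

lemma cross_eq_cases:
  assumes eq: "cross u v C B = cross u' v' C' B'"
    and C: "C \<noteq> {}" "u \<notin> C" and B: "B \<noteq> {}" "v \<notin> B"
    and C': "C' \<noteq> {}" "u' \<notin> C'" and B': "B' \<noteq> {}" "v' \<notin> B'"
  shows "u = u' \<and> v = v' \<and> C = C' \<and> B = B' \<or>
    C = {u'} \<and> B = {v'} \<and> C' = {u} \<and> B' = {v}"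
proof (cases "u = u'")
  case True
  from C(1) obtain t where t: "t \<in> C" by blast
  then have "(t, v) \<in> cross u' v' C' B'" using eq by (auto simp: cross_def)
  then have "v = v'" using t C(2) True by (auto simp: cross_def)
  then show ?thesis using cross_eq_same_centre[of u v C B C' B'] eq C(2) C'(2) True by simp
next
  case False
  have mem: "x = u \<and> y \<in> B \<or> x \<in> C \<and> y = v \<longleftrightarrow> x = u' \<and> y \<in> B' \<or> x \<in> C' \<and> y = v'" for x y
    using eq by (auto simp: cross_def set_eq_iff)
  have "y \<in> B \<longleftrightarrow> u \<in> C' \<and> y = v'" for y using mem[of u y] False C(2) by simp
  with B(1) have B1: "B = {v'}" by auto
  have "y \<in> B' \<longleftrightarrow> u' \<in> C \<and> y = v" for y using mem[of u' y] False C'(2) by auto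
  with B'(1) have B'1: "B' = {v}" by auto
  have vv': "v \<noteq> v'" using B1 B(2) by auto
  have "C = {u'}" using mem[of _ v] vv' B1 B'1 by (intro set_eqI) simp
  moreover have "C' = {u}" using mem[of _ v'] vv' B1 B'1 by (intro set_eqI) auto
  ultimately show ?thesis using B1 B'1 by simp
qed

section \<open>The three kinds of independent sets below a product neighbourhood\<close>

lemma size_poly_rows:
  assumes "finite V" and "\<And>B. B \<in> F \<Longrightarrow> B \<noteq> {}"
  shows "size_poly (\<Union>u\<in>V. (\<lambda>B. {u} \<times> B) ` F) = of_nat (card V) * size_poly F"
proof -
  have "(\<Union>u\<in>V. (\<lambda>B. {u} \<times> B) ` F) = (\<lambda>(u, B). {u} \<times> B) ` (V \<times> F)" by auto
  moreover have "inj_on (\<lambda>(u, B). {u} \<times> B) (V \<times> F)"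
    using assms(2) by (auto simp: inj_on_def times_eq_iff)
  ultimately have "size_poly (\<Union>u\<in>V. (\<lambda>B. {u} \<times> B) ` F) =
      (\<Sum>x\<in>V \<times> F. monom 1 (card (case x of (u, B) \<Rightarrow> {u} \<times> B)))"
    by (simp only: size_poly_image)
  also have "\<dots> = (\<Sum>(u, B)\<in>V \<times> F. monom 1 (card B))"
    by (intro sum.cong refl) (auto simp: card_cartesian_product)
  also have "\<dots> = of_nat (card V) * size_poly F"
    by (simp add: size_poly_def flip: sum.cartesian_product)
  finally show ?thesis .
qed

text \<open>Exchanging the coordinates turns columns into rows.\<close>

lemma size_poly_cols:
  assumes "finite V" and "\<And>C. C \<in> F \<Longrightarrow> C \<noteq> {}"
  shows "size_poly (\<Union>v\<in>V. (\<lambda>C. C \<times> {v}) ` F) = of_nat (card V) * size_poly F"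
proof -
  have "(\<Union>v\<in>V. (\<lambda>C. C \<times> {v}) ` F) = image prod.swap ` (\<Union>v\<in>V. (\<lambda>C. {v} \<times> C) ` F)"
    by (simp add: image_UN image_image product_swap)
  moreover have "inj_on (image prod.swap) X" for X :: "('a \<times> 'b) set set"
    by (rule inj_on_subset[OF inj_on_image[of _ UNIV, simplified]]) (auto simp: inj_on_def)
  moreover have "card (prod.swap ` X) = card X" for X :: "('a \<times> 'b) set"
    by (rule card_image) (auto simp: inj_on_def)
  ultimately have "size_poly (\<Union>v\<in>V. (\<lambda>C. C \<times> {v}) ` F) = size_poly (\<Union>v\<in>V. (\<lambda>C. {v} \<times> C) ` F)"
    by (simp add: size_poly_image) (simp add: size_poly_def)
  then show ?thesis using size_poly_rows[OF assms] by simp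
qed

definition cross_data :: "'a ugraph \<Rightarrow> 'b ugraph \<Rightarrow> (('a \<times> 'b) \<times> 'a set \<times> 'b set) set" where
  "cross_data G H = (SIGMA (u, v) : verts G \<times> verts H. nbhd_indeps G u \<times> nbhd_indeps H v)"

definition cross_of :: "('a \<times> 'b) \<times> 'a set \<times> 'b set \<Rightarrow> ('a \<times> 'b) set" where
  "cross_of = (\<lambda>((u, v), C, B). cross u v C B)"

text \<open>The descriptions of opposite corners of a square. Directed edges \<open>u \<rightarrow> t\<close> and \<open>v \<rightarrow> w\<close> stand for the
cross with centre \<open>(u, v)\<close> and singleton arms \<open>{t}\<close> and \<open>{w}\<close>.\<close>

definition corner_data :: "'a ugraph \<Rightarrow> 'b ugraph \<Rightarrow> (('a \<times> 'b) \<times> 'a set \<times> 'b set) set" where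
  "corner_data G H = (\<lambda>((u, t), v, w). ((u, v), {t}, {w})) ` (darts G \<times> darts H)"

lemma finite_cross_data:
  assumes "simple_graph G" and "simple_graph H"
  shows "finite (cross_data G H)"
  using assms finite_nbhd_indeps[OF assms(1)] finite_nbhd_indeps[OF assms(2)]
  by (auto simp: cross_data_def simple_graph_def intro!: finite_SigmaI)

lemma cross_dataD:
  assumes "simple_graph G" and "simple_graph H" and "((u, v), C, B) \<in> cross_data G H"
  shows "finite C" "C \<noteq> {}" "u \<notin> C" "finite B" "B \<noteq> {}" "v \<notin> B"
  using assms(3) nbhd_indepsD[OF assms(1), of C u] nbhd_indepsD[OF assms(2), of B v]
  by (simp_all add: cross_data_def)

lemma corner_data_iff:
  assumes G: "simple_graph G" and H: "simple_graph H"
  shows "((u, v), C, B) \<in> corner_data G H \<longleftrightarrow>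
    ((u, v), C, B) \<in> cross_data G H \<and> (\<exists>t w. C = {t} \<and> B = {w})"
proof -
  note single = singleton_in_nbhd_indeps_iff[OF G] singleton_in_nbhd_indeps_iff[OF H]
  have "((u, v), C, B) \<in> corner_data G H \<longleftrightarrow>
      (\<exists>t w. C = {t} \<and> B = {w} \<and> {u, t} \<in> edges G \<and> {v, w} \<in> edges H)"
    by (auto simp: corner_data_def darts_def image_iff)
  also have "\<dots> \<longleftrightarrow> ((u, v), C, B) \<in> cross_data G H \<and> (\<exists>t w. C = {t} \<and> B = {w})"
    using edge_in_verts(2)[OF G] edge_in_verts(2)[OF H]
    by (auto simp: cross_data_def single insert_commute)
  finally show ?thesis .
qed

text \<open>The arms are disjoint, so the size of a cross is the sum of the sizes of its arms, and for a fixed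
centre the sum over pairs of arms factors.\<close>

lemma sum_cross_data:
  assumes G: "simple_graph G" and H: "simple_graph H"
  shows "(\<Sum>d\<in>cross_data G H. monom 1 (card (cross_of d))) =
    (\<Sum>(u, v)\<in>verts G \<times> verts H. size_poly (nbhd_indeps G u) * size_poly (nbhd_indeps H v))"
proof -
  have "(\<Sum>d\<in>cross_data G H. monom 1 (card (cross_of d)) :: int poly) =
      (\<Sum>p\<in>verts G \<times> verts H. \<Sum>q\<in>nbhd_indeps G (fst p) \<times> nbhd_indeps H (snd p).
         monom 1 (card (cross_of (p, q))))"
    using G H finite_nbhd_indeps[OF G] finite_nbhd_indeps[OF H]
    by (subst sum.Sigma) (simp_all add: cross_data_def simple_graph_def case_prod_unfold)
  also have "\<dots> = (\<Sum>p\<in>verts G \<times> verts H.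
      size_poly (nbhd_indeps G (fst p)) * size_poly (nbhd_indeps H (snd p)))"
  proof (rule sum.cong[OF refl])
    fix p
    have "(\<Sum>q\<in>nbhd_indeps G (fst p) \<times> nbhd_indeps H (snd p). monom 1 (card (cross_of (p, q)))) =
      (\<Sum>(C, B)\<in>nbhd_indeps G (fst p) \<times> nbhd_indeps H (snd p).
         monom 1 (card C) * monom 1 (card B) :: int poly)"
      using nbhd_indepsD[OF G] nbhd_indepsD[OF H]
      by (intro sum.cong refl)
        (auto simp: cross_of_def card_cross mult_monom case_prod_beta)
    then show "(\<Sum>q\<in>nbhd_indeps G (fst p) \<times> nbhd_indeps H (snd p). monom 1 (card (cross_of (p, q)))) =
      size_poly (nbhd_indeps G (fst p)) * size_poly (nbhd_indeps H (snd p))"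
      by (simp add: size_poly_def sum_product sum.cartesian_product)
  qed
  finally show ?thesis by (simp add: case_prod_beta)
qed

text \<open>Reversing both directed edges exchanges the centre of the cross with the fourth corner of the
square and leaves the set unchanged.\<close>

lemma card_corner_sets:
  assumes G: "simple_graph G" and H: "simple_graph H"
  shows "card (cross_of ` corner_data G H) = 2 * card (edges G) * card (edges H)"
proof -
  let ?m = "\<lambda>((u, t), v, w). ((u, v), {t}, {w})"
  let ?D = "darts G \<times> darts H"
  have "card ?D = 2 * card ((\<lambda>d. cross_of (?m d)) ` ?D)"
  proof (rule card_two_to_one[where \<sigma> = "map_prod prod.swap prod.swap"])
    fix x y assume x: "x \<in> ?D" and y: "y \<in> ?D"
    obtain u t v w where x': "x = ((u, t), v, w)" by (metis surj_pair)
    obtain a b c d where y': "y = ((a, b), c, d)" by (metis surj_pair)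
    have "u \<noteq> t" "v \<noteq> w" "a \<noteq> b" "c \<noteq> d"
      using x y x' y' edge_in_verts(3)[OF G] edge_in_verts(3)[OF H] by (auto simp: darts_def)
    then show "cross_of (?m y) = cross_of (?m x) \<longleftrightarrow> y = x \<or> y = map_prod prod.swap prod.swap x"
      unfolding x' y' by (auto simp: cross_of_def cross_def doubleton_eq_iff)
  next
    show "finite ?D" using finite_darts[OF G] finite_darts[OF H] by simp
  qed (use edge_in_verts(3)[OF G] in \<open>auto simp: darts_def insert_commute\<close>)
  moreover have "(\<lambda>d. cross_of (?m d)) ` ?D = cross_of ` corner_data G H"
    by (simp add: corner_data_def image_image)
  ultimately show ?thesis by (simp add: card_cartesian_product card_darts[OF G] card_darts[OF H])
qed

lemma card_corner_data:
  assumes "simple_graph G" and "simple_graph H"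
  shows "card (corner_data G H) = 4 * card (edges G) * card (edges H)"
proof -
  have "inj_on (\<lambda>((u, t), v, w). ((u, v), {t}, {w})) (darts G \<times> darts H)"
    by (auto simp: inj_on_def)
  then show ?thesis
    using assms by (simp add: corner_data_def card_image card_cartesian_product card_darts)
qed

text \<open>Forming the cross is injective off the corner data, and corner data and other data give different
sets. On the corner data it is two-to-one, so the sum over all data exceeds the sum over sets by
\<open>(4 - 2)|E\<^sub>1||E\<^sub>2|x\<^sup>2\<close>.\<close>

lemma size_poly_crosses:
  assumes G: "simple_graph G" and H: "simple_graph H"
  shows "size_poly (cross_of ` cross_data G H) =
    (\<Sum>(u, v)\<in>verts G \<times> verts H. size_poly (nbhd_indeps G u) * size_poly (nbhd_indeps H v))
    - of_nat (2 * card (edges G) * card (edges H)) * monom 1 2"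
proof -
  let ?D = "cross_data G H" and ?S = "corner_data G H"
  let ?x = "\<lambda>d. monom 1 (card (cross_of d)) :: int poly"
  have fin: "finite ?D" using finite_cross_data[OF G H] .
  have sub: "?S \<subseteq> ?D" using corner_data_iff[OF G H] by force
  have coincide: "d = e \<or> d \<in> ?S \<and> e \<in> ?S"
    if de: "d \<in> ?D" "e \<in> ?D" "cross_of d = cross_of e" for d e
  proof -
    obtain u v C B where d: "d = ((u, v), C, B)" by (metis surj_pair)
    obtain u' v' C' B' where e: "e = ((u', v'), C', B')" by (metis surj_pair)
    have "u = u' \<and> v = v' \<and> C = C' \<and> B = B' \<or>
        C = {u'} \<and> B = {v'} \<and> C' = {u} \<and> B' = {v}"
      using de cross_dataD[OF G H, of u v C B] cross_dataD[OF G H, of u' v' C' B']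
      unfolding d e cross_of_def by (intro cross_eq_cases) auto
    then show ?thesis using de corner_data_iff[OF G H] unfolding d e by auto
  qed
  have card2: "card (cross_of d) = 2" if "d \<in> ?S" for d
  proof -
    obtain u v C B where d: "d = ((u, v), C, B)" by (metis surj_pair)
    have "d \<in> ?D" using that sub by blast
    then show ?thesis using that cross_dataD[OF G H, of u v C B]
      unfolding d by (auto simp: corner_data_iff[OF G H] cross_of_def card_cross)
  qed
  have "cross_of ` ?D = cross_of ` (?D - ?S) \<union> cross_of ` ?S" using sub by blast
  moreover have "cross_of ` (?D - ?S) \<inter> cross_of ` ?S = {}" using coincide sub by blast
  moreover have "finite (cross_of ` (?D - ?S))" "finite (cross_of ` ?S)"
    using fin sub finite_subset by blast+
  ultimately have "size_poly (cross_of ` ?D) =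
      size_poly (cross_of ` (?D - ?S)) + size_poly (cross_of ` ?S)"
    using size_poly_Un[of "cross_of ` (?D - ?S)" "cross_of ` ?S"] by (simp add: size_poly_def[of "{}"])
  moreover have "size_poly (cross_of ` (?D - ?S)) = (\<Sum>d\<in>?D - ?S. ?x d)"
    by (intro size_poly_image inj_onI) (use coincide in blast)
  moreover have "(\<Sum>d\<in>?D. ?x d) = (\<Sum>d\<in>?D - ?S. ?x d) + (\<Sum>d\<in>?S. ?x d)"
    using sum.subset_diff[OF sub fin] .
  moreover have "(\<Sum>d\<in>?S. ?x d) = of_nat (4 * card (edges G) * card (edges H)) * monom 1 2"
    using card2 card_corner_data[OF G H] by simp
  moreover have "size_poly (cross_of ` ?S) = of_nat (2 * card (edges G) * card (edges H)) * monom 1 2"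
    using card2 card_corner_sets[OF G H] by (subst size_poly_const_card) auto
  ultimately show ?thesis
    using sum_cross_data[OF G H] by (simp add: algebra_simps)
qed

theorem theorem3:
  fixes G1 G2 :: "'a ugraph"
  assumes "simple_graph G1" and "simple_graph G2"
    and "verts G1 \<inter> verts G2 = {}"
    and "verts G1 \<noteq> {}" and "verts G2 \<noteq> {}"
    and "\<nexists>v. isolated G1 v" and "\<nexists>v. isolated G2 v"
  shows "indep_nbhd_poly (cart_prod G1 G2) =
      1 + of_nat (card (verts G1)) * (indep_nbhd_poly G2 - 1)
        + of_nat (card (verts G2)) * (indep_nbhd_poly G1 - 1)
        + (\<Sum>(u, v) \<in> verts G1 \<times> verts G2.
             (indep_poly (induced G1 (nbhd G1 u)) - 1) *
             (indep_poly (induced G2 (nbhd G2 v)) - 1))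
        - of_nat (card (verts G1) * card (verts G2)) * monom 1 1
        - of_nat (2 * card (edges G1) * card (edges G2)) * monom 1 2"
proof -
  note G = assms(1) and H = assms(2)
  let ?F1 = "\<Union>u\<in>verts G1. nbhd_indeps G1 u" and ?F2 = "\<Union>v\<in>verts G2. nbhd_indeps G2 v"
  let ?rows = "\<Union>u\<in>verts G1. (\<lambda>B. {u} \<times> B) ` ?F2"
  let ?cols = "\<Union>v\<in>verts G2. (\<lambda>C. C \<times> {v}) ` ?F1"
  let ?crosses = "cross_of ` cross_data G1 G2"
  let ?singles = "(\<lambda>p. {p}) ` (verts G1 \<times> verts G2)"
  have finV: "finite (verts G1)" "finite (verts G2)" using G H by (simp_all add: simple_graph_def)
  have fin: "finite ?rows" "finite ?cols" "finite ?crosses"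
    using finV finite_nbhd_indeps[OF G] finite_nbhd_indeps[OF H] finite_cross_data[OF G H] by auto
  have ne: "A \<noteq> {}" if "A \<in> ?F1" for A using that by (auto simp: nbhd_indeps_def)
  have ne': "A \<noteq> {}" if "A \<in> ?F2" for A using that by (auto simp: nbhd_indeps_def)

  have "(\<Union>p\<in>verts G1 \<times> verts G2. nbhd_indeps (cart_prod G1 G2) p) =
      (\<Union>u\<in>verts G1. \<Union>v\<in>verts G2. (\<lambda>B. {u} \<times> B) ` nbhd_indeps G2 v \<union>
        (\<lambda>C. C \<times> {v}) ` nbhd_indeps G1 u \<union>
        (\<lambda>(C, B). cross u v C B) ` (nbhd_indeps G1 u \<times> nbhd_indeps G2 v))"
  proof -
    have "(\<Union>p\<in>verts G1 \<times> verts G2. X p) = (\<Union>u\<in>verts G1. \<Union>v\<in>verts G2. X (u, v))"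
      for X :: "'a \<times> 'a \<Rightarrow> ('a \<times> 'a) set set" by auto
    then show ?thesis using nbhd_indeps_cart_prod[OF G H] by simp
  qed
  also have "\<dots> = ?rows \<union> ?cols \<union> ?crosses"
  proof -
    have "?cols = (\<Union>u\<in>verts G1. \<Union>v\<in>verts G2. (\<lambda>C. C \<times> {v}) ` nbhd_indeps G1 u)"
      unfolding image_UN by (rule SUP_commute)
    moreover have "cross_data G1 G2 =
        (\<Union>u\<in>verts G1. \<Union>v\<in>verts G2. Pair (u, v) ` (nbhd_indeps G1 u \<times> nbhd_indeps G2 v))"
      by (auto simp: cross_data_def)
    then have "?crosses = (\<Union>u\<in>verts G1. \<Union>v\<in>verts G2.
        (\<lambda>(C, B). cross u v C B) ` (nbhd_indeps G1 u \<times> nbhd_indeps G2 v))"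
      by (simp add: image_UN image_image cross_of_def)
    ultimately show ?thesis by (simp only: UN_Un_distrib image_UN)
  qed
  finally have dec: "(\<Union>p\<in>verts G1 \<times> verts G2. nbhd_indeps (cart_prod G1 G2) p) = \<dots>" .

  \<comment> \<open>a neighbour of \<open>a\<close> witnesses that \<open>{a}\<close> lies below a neighbourhood\<close>
  have single: "{a} \<in> (\<Union>v\<in>verts K. nbhd_indeps K v)"
    if K: "simple_graph K" and iso: "\<nexists>v. isolated K v" and a: "a \<in> verts K" for K :: "'a ugraph" and a
  proof -
    obtain b where "{b, a} \<in> edges K" using iso a by (auto simp: isolated_def nbhd_def)
    then have "b \<in> verts K" "{a} \<in> nbhd_indeps K b"
      using singleton_in_nbhd_indeps_iff[OF K, of a b] edge_in_verts(1)[OF K]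
      by (blast, simp add: insert_commute)
    then show ?thesis by blast
  qed
  have inter: "?rows \<inter> ?cols = ?singles"
  proof (intro equalityI subsetI)
    fix A assume A: "A \<in> ?rows \<inter> ?cols"
    obtain u B where u: "u \<in> verts G1" "B \<in> ?F2" "A = {u} \<times> B" using A by blast
    obtain v C where v: "v \<in> verts G2" "A = C \<times> {v}" using A by blast
    have "{u} \<times> B = C \<times> {v}" using u(3) v(2) by simp
    then have "A = {(u, v)}" using u(3) ne'[OF u(2)] by (auto simp: times_eq_iff)
    then show "A \<in> ?singles" using u(1) v(1) by blast
  next
    fix A assume "A \<in> ?singles"
    then obtain u v where uv: "u \<in> verts G1" "v \<in> verts G2" and A: "A = {u} \<times> {v}" by auto
    have "A \<in> ?rows" unfolding A
      by (rule UN_I[OF uv(1)], rule imageI, rule single[OF H assms(7) uv(2)])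
    moreover have "A \<in> ?cols" unfolding A
      by (rule UN_I[OF uv(2)], rule imageI, rule single[OF G assms(6) uv(1)])
    ultimately show "A \<in> ?rows \<inter> ?cols" by blast
  qed
  \<comment> \<open>a cross has points \<open>(u, w)\<close> and \<open>(t, v)\<close> that differ in both coordinates\<close>
  have disj: "(?rows \<union> ?cols) \<inter> ?crosses = {}"
  proof (rule equals0I, elim IntE imageE)
    fix A d assume A: "A \<in> ?rows \<union> ?cols" "A = cross_of d" "d \<in> cross_data G1 G2"
    obtain u v C B where d: "d = ((u, v), C, B)" by (metis surj_pair)
    note * = cross_dataD[OF G H A(3)[unfolded d]]
    from *(2,5) obtain t w where "t \<in> C" "w \<in> B" by blast
    then have "(u, w) \<in> A" "(t, v) \<in> A" "u \<noteq> t" "v \<noteq> w"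
      using A(2) d * by (auto simp: cross_of_def cross_def)
    moreover from A(1) consider a B' where "A = {a} \<times> B'" | b C' where "A = C' \<times> {b}" by blast
    ultimately show False by cases auto
  qed

  have "indep_nbhd_poly (cart_prod G1 G2) - 1 = size_poly (?rows \<union> ?cols \<union> ?crosses)"
    using indep_nbhd_poly_minus_one[OF simple_graph_cart_prod[OF G H]] assms(4,5) dec
    by (simp add: verts_cart_prod)
  also have "\<dots> = size_poly ?rows + size_poly ?cols - size_poly ?singles + size_poly ?crosses"
  proof -
    have "size_poly (?rows \<union> ?cols \<union> ?crosses) = size_poly (?rows \<union> ?cols) + size_poly ?crosses"
      using size_poly_Un[OF finite_UnI[OF fin(1,2)] fin(3)] unfolding disj by (simp add: size_poly_def)
    then show ?thesis using size_poly_Un[OF fin(1,2)] unfolding inter by simp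
  qed
  also have "size_poly ?rows = of_nat (card (verts G1)) * (indep_nbhd_poly G2 - 1)"
    unfolding indep_nbhd_poly_minus_one[OF H assms(5)] using ne' by (intro size_poly_rows[OF finV(1)])
  also have "size_poly ?cols = of_nat (card (verts G2)) * (indep_nbhd_poly G1 - 1)"
    unfolding indep_nbhd_poly_minus_one[OF G assms(4)] using ne by (intro size_poly_cols[OF finV(2)])
  also have "size_poly ?singles = of_nat (card (verts G1) * card (verts G2)) * monom 1 1"
    by (subst size_poly_const_card[where k = 1])
      (auto simp: card_image inj_on_def card_cartesian_product)
  also have "size_poly ?crosses = (\<Sum>(u, v) \<in> verts G1 \<times> verts G2.
             (indep_poly (induced G1 (nbhd G1 u)) - 1) *
             (indep_poly (induced G2 (nbhd G2 v)) - 1))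
        - of_nat (2 * card (edges G1) * card (edges G2)) * monom 1 2"
    using size_poly_crosses[OF G H] indep_poly_nbhd_minus_one[OF G] indep_poly_nbhd_minus_one[OF H]
    by simp
  finally show ?thesis by (simp add: algebra_simps)
qed

end
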